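(* Consider an instance $(N,d,r)$ with cardinality-based rates $r=(r_1,\dots,r_N)$. If the all-at-once strategy $\mathcal H^N$ is optimal for $(N,d,r)$, then $$(m-1)\,r_{m-1}\le m\,r_m\qquad\text{for all } m=2,\dots,N .$$
   Context: $\mathcal N=\{1,\dots,N\}$ is a set of links with a vector $d=(d_1,\dots,d_N)$ of strictly positive demands (queue contents). $\mathcal H$ is the set of all nonempty subsets of $\mathcal N$, called groups. Cardinality-based rates: there are numbers $r_1\ge r_2\ge\dots\ge r_N\ge 0$ such that, when group $c$ is active, every link $i\in c$ is served at rate $r_{|c|}$ and every link outside $c$ at rate $0$. A schedule is a vector $T=(T_c)_{c\in\mathcal H}\ge 0$ of activation times with $\sum_{c\ni i}r_{|c|}T_c=d_i$ for every $i\in\mathcal N$; its length is $\sum_{c\in\mathcal H}T_c$, and it is optimal if its length is minimum among all schedules. The strategy $\mathcal H^N$: activate the group of all $N$ links until some queue becomes empty; the next group consists of all links with positive remaining demand, and so on until all queues are empty. It is regarded as consisting of $N$ groups of sizes $N,N-1,\dots,1$, the links being removed in the order in which their queues empty; in case of degeneracy (several queues emptying at the same time) the structure remains, with time duration zero for some of these groups.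
   Formalization: The inequality is proved only for those m whose group of size m is active for a positive time (all m if the demands are distinct); with ties it can fail: N=3, d=(1,1,1), r=(1,2/5,7/20) makes the all-at-once strategy optimal, but r_1 > 2r_2. *)

theory Defs
  imports Complex_Main
begin

definition groups :: "nat \<Rightarrow> nat set set" where
  "groups N = {c. c \<subseteq> {1..N} \<and> c \<noteq> {}}"

definition cardinality_based_instance :: "nat \<Rightarrow> (nat \<Rightarrow> real) \<Rightarrow> (nat \<Rightarrow> real) \<Rightarrow> bool" where
  "cardinality_based_instance N d r \<longleftrightarrow>
     (\<forall>i\<in>{1..N}. 0 < d i) \<and> antimono_on {1..N} r \<and> (\<forall>m\<in>{1..N}. 0 \<le> r m)"

definition schedule :: "nat \<Rightarrow> (nat \<Rightarrow> real) \<Rightarrow> (nat \<Rightarrow> real) \<Rightarrow> (nat set \<Rightarrow> real) \<Rightarrow> bool" where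
  "schedule N d r T \<longleftrightarrow>
     (\<forall>c\<in>groups N. 0 \<le> T c) \<and>
     (\<forall>i\<in>{1..N}. (\<Sum>c\<in>{c\<in>groups N. i \<in> c}. r (card c) * T c) = d i)"

definition schedule_length :: "nat \<Rightarrow> (nat set \<Rightarrow> real) \<Rightarrow> real" where
  "schedule_length N T = (\<Sum>c\<in>groups N. T c)"

definition optimal_schedule :: "nat \<Rightarrow> (nat \<Rightarrow> real) \<Rightarrow> (nat \<Rightarrow> real) \<Rightarrow> (nat set \<Rightarrow> real) \<Rightarrow> bool" where
  "optimal_schedule N d r T \<longleftrightarrow>
     schedule N d r T \<and>
     (\<forall>T'. schedule N d r T' \<longrightarrow> schedule_length N T \<le> schedule_length N T')"

definition emptying_time :: "(nat \<Rightarrow> real) \<Rightarrow> nat set \<Rightarrow> (nat \<Rightarrow> real) \<Rightarrow> real" where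
  "emptying_time r c q = Min (q ` c) / r (card c)"

text \<open>
  The pair holds the group that is active in stage k (counted from 0) and the queue contents at the
  start of that stage. Exactly one link, one of those whose queue empties first, is removed per
  stage, so that there are always N groups, of sizes N, ..., 1. If several queues empty at the same
  time, the links still to be removed have an empty queue and the stages that remove them take time
  zero; the tie-breaking therefore does not affect the activation times.

  If r N = 0, the division gives the first stage time zero, and the link removed from it is never
  served. The result is then not a schedule, since demands are positive, and so it is not optimal.
\<close>
primrec all_at_once_state ::
    "nat \<Rightarrow> (nat \<Rightarrow> real) \<Rightarrow> (nat \<Rightarrow> real) \<Rightarrow> nat \<Rightarrow> nat set \<times> (nat \<Rightarrow> real)" where
  "all_at_once_state N d r 0 = ({1..N}, d)"
| "all_at_once_state N d r (Suc k) =
     (let (c, q) = all_at_once_state N d r k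
      in (c - {arg_min_on q c},
          \<lambda>i. if i \<in> c then q i - r (card c) * emptying_time r c q else q i))"

definition stage_group :: "nat \<Rightarrow> (nat \<Rightarrow> real) \<Rightarrow> (nat \<Rightarrow> real) \<Rightarrow> nat \<Rightarrow> nat set" where
  "stage_group N d r k = fst (all_at_once_state N d r k)"

text \<open>
  The group of size m is active in stage N - m. When the rates are positive, all stage times are
  positive iff the demands are pairwise distinct.

  Optimality of the strategy says nothing about the rate of a group that is active for time zero:
  with three links of demand 1 and rates 1, 2/5, 7/20 the strategy is optimal, but
  1 * r 1 > 2 * r 2.
\<close>
definition stage_time :: "nat \<Rightarrow> (nat \<Rightarrow> real) \<Rightarrow> (nat \<Rightarrow> real) \<Rightarrow> nat \<Rightarrow> real" where
  "stage_time N d r k =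
     emptying_time r (fst (all_at_once_state N d r k)) (snd (all_at_once_state N d r k))"

definition all_at_once :: "nat \<Rightarrow> (nat \<Rightarrow> real) \<Rightarrow> (nat \<Rightarrow> real) \<Rightarrow> nat set \<Rightarrow> real" where
  "all_at_once N d r c = (\<Sum>k<N. if stage_group N d r k = c then stage_time N d r k else 0)"

end

theory Submission
  imports Defs
begin

text \<open>
  In an optimal schedule, a group \<open>c\<close> of size \<open>m\<close> with positive activation time \<open>e\<close> can be replaced
  by its \<open>m\<close> subgroups of size \<open>m - 1\<close>. A link of \<open>c\<close> lies in \<open>m - 1\<close> of them, so running each for
  time \<open>r m * e / ((m - 1) * r (m - 1))\<close> keeps the service of every link. Optimality forces the
  total length of the replacements to be at least \<open>e\<close>, which is the claimed inequality.
\<close>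

text \<open>The subgroups \<open>c - {j}\<close> may be active in \<open>T\<close> already, so
  \<delta> is added on top of \<open>T x\<close>. Distinct \<open>j\<close> in \<open>c\<close> give
  distinct subgroups, so at most one summand applies to each \<open>x\<close>.\<close>

definition split_group :: "(nat set \<Rightarrow> real) \<Rightarrow> nat set \<Rightarrow> real \<Rightarrow> nat set \<Rightarrow> real" where
  "split_group T c \<delta> x = (if x = c then 0 else T x) + (\<Sum>j\<in>c. if x = c - {j} then \<delta> else 0)"

text \<open>Serves two purposes: weights \<open>r (card x)\<close> over the groups containing a link
  give its service, weight 1 over all groups gives the length. Under each indicator the weight
  becomes constant, so the sums over \<open>A\<close> collapse after swapping.\<close>

lemma sum_split_group:
  assumes "finite A" "finite c"
  shows "(\<Sum>x\<in>A. g x * split_group T c \<delta> x) =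
    (\<Sum>x\<in>A. g x * T x) - (if c \<in> A then g c * T c else 0)
      + (\<Sum>j\<in>c. if c - {j} \<in> A then g (c - {j}) * \<delta> else 0)"
proof -
  have "g x * split_group T c \<delta> x = (g x * T x - (if x = c then g c * T c else 0))
      + (\<Sum>j\<in>c. if x = c - {j} then g (c - {j}) * \<delta> else 0)" for x
    unfolding split_group_def distrib_left sum_distrib_left
    by (intro arg_cong2[where f = "(+)"] sum.cong) auto
  then have "(\<Sum>x\<in>A. g x * split_group T c \<delta> x) =
      (\<Sum>x\<in>A. g x * T x) - (\<Sum>x\<in>A. if x = c then g c * T c else 0)
      + (\<Sum>x\<in>A. \<Sum>j\<in>c. if x = c - {j} then g (c - {j}) * \<delta> else 0)"
    by (simp add: sum.distrib sum_subtractf)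
  also have "(\<Sum>x\<in>A. \<Sum>j\<in>c. if x = c - {j} then g (c - {j}) * \<delta> else 0) =
      (\<Sum>j\<in>c. \<Sum>x\<in>A. if x = c - {j} then g (c - {j}) * \<delta> else 0)"
    by (rule sum.swap)
  finally show ?thesis
    using assms by simp
qed

lemma finite_groups: "finite (groups N)"
  unfolding groups_def by (rule finite_subset[of _ "Pow {1..N}"]) auto

lemma groups_finite: "c \<in> groups N \<Longrightarrow> finite c"
  unfolding groups_def using finite_subset by auto

lemma diff_singleton_in_groups:
  assumes "c \<in> groups N" "2 \<le> card c"
  shows "c - {j} \<in> groups N"
proof -
  have "c - {j} \<noteq> {}"
    using assms(2) card_mono[of "{j}" c] by auto
  with assms(1) show ?thesis
    unfolding groups_def by auto
qed

lemma optimal_schedule_active_group_rate: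
  assumes opt: "optimal_schedule N d r T"
    and c: "c \<in> groups N" "2 \<le> card c" "0 < T c"
    and r: "0 \<le> r (card c)"
  shows "real (card c - 1) * r (card c - 1) \<le> real (card c) * r (card c)"
\<comment> \<open>The construction divides by \<open>r (card c - 1)\<close>; if this rate is not
  positive, the left side is at most 0 anyway.\<close>
proof (cases "r (card c - 1) \<le> 0")
  case True
  then have "real (card c - 1) * r (card c - 1) \<le> 0"
    by (simp add: mult_nonneg_nonpos)
  also have "\<dots> \<le> real (card c) * r (card c)"
    using r by simp
  finally show ?thesis .
next
  case False
  define p where "p = real (card c - 1) * r (card c - 1)"
  define \<delta> where "\<delta> = r (card c) * T c / p"
  have p: "0 < p"
    using False c(2) by (simp add: p_def)
  then have \<delta>: "0 \<le> \<delta>" "p * \<delta> = r (card c) * T c"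
    using r c(3) by (simp_all add: \<delta>_def)
  have T: "\<And>x. x \<in> groups N \<Longrightarrow> 0 \<le> T x"
    "\<And>i. i \<in> {1..N} \<Longrightarrow> (\<Sum>x\<in>{x\<in>groups N. i \<in> x}. r (card x) * T x) = d i"
    using opt unfolding optimal_schedule_def schedule_def by auto
  have fin: "finite c"
    using c(1) by (rule groups_finite)
  have sub: "c - {j} \<in> groups N" for j
    using diff_singleton_in_groups c(1,2) .
  have "(\<Sum>x\<in>{x\<in>groups N. i \<in> x}. r (card x) * split_group T c \<delta> x) = d i"
    if i: "i \<in> {1..N}" for i
  proof (cases "i \<in> c")
    case True
    \<comment> \<open>Link \<open>i\<close> is missing only from the subgroup with
      \<open>j = i\<close>. The other \<open>card c - 1\<close> subgroups together give it
      \<open>p * \<delta>\<close>, exactly the service lost by dropping \<open>c\<close>.\<close>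
    have "(\<Sum>j\<in>c. if c - {j} \<in> {x\<in>groups N. i \<in> x} then r (card (c - {j})) * \<delta> else 0) =
        (\<Sum>j\<in>c. if j \<noteq> i then r (card c - 1) * \<delta> else 0)"
      using True sub fin by (intro sum.cong) auto
    also have "\<dots> = (\<Sum>j\<in>c - {i}. r (card c - 1) * \<delta>)"
      using fin by (intro sum.mono_neutral_cong_right) auto
    also have "\<dots> = p * \<delta>"
      using True by (simp add: p_def)
    finally show ?thesis
      using sum_split_group[of "{x\<in>groups N. i \<in> x}" c "\<lambda>x. r (card x)" T \<delta>]
      using True c(1) \<delta>(2) T(2)[OF i] fin finite_groups[of N] by simp
  next
    case False
    then show ?thesis
      using sum_split_group[of "{x\<in>groups N. i \<in> x}" c "\<lambda>x. r (card x)" T \<delta>]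
      using T(2)[OF i] fin finite_groups[of N] by simp
  qed
  moreover have "0 \<le> split_group T c \<delta> x" if "x \<in> groups N" for x
    unfolding split_group_def using T(1)[OF that] \<delta>(1) by (intro add_nonneg_nonneg sum_nonneg) auto
  ultimately have "schedule N d r (split_group T c \<delta>)"
    unfolding schedule_def by blast
  then have "schedule_length N T \<le> schedule_length N (split_group T c \<delta>)"
    using opt unfolding optimal_schedule_def by blast
  also have "\<dots> = schedule_length N T - T c + real (card c) * \<delta>"
    unfolding schedule_length_def
    using sum_split_group[of "groups N" c "\<lambda>_. 1" T \<delta>] fin finite_groups[of N] c(1) sub by simp
  \<comment> \<open>Scaling by \<open>p\<close> lets \<open>p * \<delta>\<close> be replaced by
    \<open>r (card c) * T c\<close>, after which \<open>T c\<close> cancels.\<close>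
  finally have "p * T c \<le> p * (real (card c) * \<delta>)"
    using p by simp
  also have "\<dots> = real (card c) * r (card c) * T c"
    using \<delta>(2) by (simp add: ac_simps)
  finally show ?thesis
    using c(3) unfolding p_def by simp
qed

text \<open>Before stage \<open>N\<close> the group is finite and nonempty, so
  \<open>arg_min_on\<close> picks a genuine member and each stage removes exactly one link.\<close>

lemma stage_group_subset_card:
  assumes "k \<le> N"
  shows "stage_group N d r k \<subseteq> {1..N} \<and> card (stage_group N d r k) = N - k"
  using assms
proof (induction k)
  case 0
  then show ?case by (simp add: stage_group_def)
next
  case (Suc k)
  define c q where "c = fst (all_at_once_state N d r k)" and "q = snd (all_at_once_state N d r k)"
  have c: "c \<subseteq> {1..N}" "card c = N - k"
    using Suc by (auto simp: c_def stage_group_def)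
  then have "finite c" "c \<noteq> {}"
    using Suc.prems finite_subset by auto
  then have "arg_min_on q c \<in> c"
    by (rule arg_min_if_finite(1))
  moreover have "stage_group N d r (Suc k) = c - {arg_min_on q c}"
    by (simp add: stage_group_def c_def q_def case_prod_unfold Let_def)
  ultimately show ?case
    using c by auto
qed

text \<open>Groups of different stages have different sizes, so only one term of the sum defining
  \<open>all_at_once\<close> survives.\<close>

lemma all_at_once_stage_group:
  assumes "k < N"
  shows "all_at_once N d r (stage_group N d r k) = stage_time N d r k"
proof -
  have "stage_group N d r l = stage_group N d r k \<longleftrightarrow> l = k" if "l < N" for l
    using stage_group_subset_card[of l N d r] stage_group_subset_card[of k N d r] that assms
    by (metis diff_diff_cancel less_imp_le)
  then have "all_at_once N d r (stage_group N d r k) =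
      (\<Sum>l<N. if l = k then stage_time N d r l else 0)"
    unfolding all_at_once_def by (intro sum.cong) auto
  with assms show ?thesis by simp
qed

theorem corollary10:
  fixes N :: nat and d r :: "nat \<Rightarrow> real"
  assumes "cardinality_based_instance N d r"
    and "optimal_schedule N d r (all_at_once N d r)"
  shows "\<forall>m\<in>{2..N}. 0 < stage_time N d r (N - m) \<longrightarrow> real (m - 1) * r (m - 1) \<le> real m * r m"
proof (intro ballI impI)
  fix m
  assume m: "m \<in> {2..N}" and pos: "0 < stage_time N d r (N - m)"
  \<comment> \<open>This stage has a group of size \<open>N - (N - m) = m\<close>; its positive
    duration makes it an active group that can be split.\<close>
  define c where "c = stage_group N d r (N - m)"
  have c: "c \<subseteq> {1..N}" "card c = m"
    using stage_group_subset_card[of "N - m" N d r] m by (auto simp: c_def)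
  then have "c \<in> groups N"
    using m by (auto simp: groups_def)
  moreover have "0 < all_at_once N d r c"
    using all_at_once_stage_group[of "N - m" N d r] m pos by (simp add: c_def)
  moreover have "0 \<le> r m"
    using assms(1) m by (auto simp: cardinality_based_instance_def)
  ultimately show "real (m - 1) * r (m - 1) \<le> real m * r m"
    using optimal_schedule_active_group_rate[OF assms(2), of c] c(2) m by simp
qed

end
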